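(* Let $d\ge 1$ be an integer and let $\mathbf{X}\subset\mathbb{R}^d$ be a spatial Poisson cluster process with immigrant intensity $\nu\in(0,\infty)$ and cluster radius $L$. Let $v(r)=P(N_{\mathbf{X}}(b(0,r))=0)$, $r>0$, be its void probability function. Assume $\mathrm{E}[L^d]<\infty$. Then $$\lim_{r\to\infty}\frac{1}{\omega_d(r)}\log v(r)=-\nu.$$
   Context: Spatial Poisson cluster process. The immigrants (cluster centers) are the points $\{X_i\}$ of a homogeneous Poisson process $I\subset\mathbb{R}^d$ with intensity $\nu\in(0,\infty)$. Each immigrant $X_i\in I$ generates a cluster $C_i=C_{X_i}$, a finite point process in $\mathbb{R}^d$ containing $X_i$. Given $I$, the centered clusters $C_{X_i}-X_i=\{Y-X_i:Y\in C_{X_i}\}$ are independent, identically distributed, and independent of $I$. $\mathbf{X}$ is the union of all clusters. $C_0$ denotes the cluster generated by a point at $0$ (i.e. a point process with the common law of the centered clusters); the number $S$ of points in $C_0$ satisfies the standing assumption $\mathrm{E}[S]<\infty$; $L=\sup_{Y\in C_0}\|Y\|$ is the radius of $C_0$ ($\|\cdot\|$ the Euclidean norm). $b(0,r)$ is the Euclidean ball of radius $r$ centered at $0$, $N_{\mathbf{X}}(b(0,r))$ is the number of points of $\mathbf{X}$ in $b(0,r)$, and $\omega_d(r)=r^d\pi^{d/2}/\Gamma(1+d/2)$ is the volume of $b(0,r)$. *)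

theory Defs
  imports "HOL-Probability.Probability" "HOL-Library.Extended_Nat"
begin

text \<open>
  Point processes are random locally finite subsets of a Euclidean space. As in the usual
  definition, a point process takes values in the space of configurations, which carries the
  smallest sigma-algebra making all counts over Borel sets measurable.
\<close>

definition locally_finite :: "'a::metric_space set \<Rightarrow> bool" where
  "locally_finite \<phi> \<longleftrightarrow> (\<forall>K. bounded K \<longrightarrow> finite (\<phi> \<inter> K))"

definition num_points :: "'a set \<Rightarrow> 'a set \<Rightarrow> enat" where
  "num_points \<phi> B = (if finite (\<phi> \<inter> B) then enat (card (\<phi> \<inter> B)) else \<infinity>)"

definition configurations :: "'a::euclidean_space set measure" where
  "configurations = sigma {\<phi>. locally_finite \<phi>}
     {{\<phi>. locally_finite \<phi> \<and> num_points \<phi> B = n} | B n. B \<in> sets borel}"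

definition point_process :: "'w measure \<Rightarrow> ('w \<Rightarrow> 'a::euclidean_space set) \<Rightarrow> bool" where
  "point_process M \<Phi> \<longleftrightarrow> prob_space M \<and> \<Phi> \<in> measurable M configurations"

definition finite_point_process :: "'w measure \<Rightarrow> ('w \<Rightarrow> 'a::euclidean_space set) \<Rightarrow> bool" where
  "finite_point_process M \<Phi> \<longleftrightarrow> point_process M \<Phi> \<and> (\<forall>\<omega>\<in>space M. finite (\<Phi> \<omega>))"

text \<open>
  The Poisson weights are written out because the library's \<open>poisson_pmf\<close> requires a positive
  rate, while the volume of \<open>B\<close> may be zero here.
\<close>

definition homogeneous_poisson_process ::
  "'w measure \<Rightarrow> real \<Rightarrow> ('w \<Rightarrow> 'a::euclidean_space set) \<Rightarrow> bool" where
  "homogeneous_poisson_process M \<nu> I \<longleftrightarrow>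
     point_process M I \<and>
     (\<forall>B k. B \<in> sets borel \<longrightarrow> bounded B \<longrightarrow>
        measure M {\<omega> \<in> space M. num_points (I \<omega>) B = enat k} =
          (\<nu> * measure lborel B) ^ k / fact k * exp (- (\<nu> * measure lborel B))) \<and>
     (\<forall>\<B>. finite \<B> \<longrightarrow> disjoint \<B> \<longrightarrow> (\<forall>B\<in>\<B>. B \<in> sets borel \<and> bounded B) \<longrightarrow>
        prob_space.indep_vars M (\<lambda>_. count_space UNIV) (\<lambda>B \<omega>. num_points (I \<omega>) B) \<B>)"

definition centered_cluster ::
  "(nat \<Rightarrow> 'w \<Rightarrow> 'a::euclidean_space) \<Rightarrow> (nat \<Rightarrow> 'w \<Rightarrow> 'a set) \<Rightarrow> nat \<Rightarrow> 'w \<Rightarrow> 'a set" where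
  "centered_cluster X C i \<omega> = (\<lambda>y. y - X i \<omega>) ` C i \<omega>"

text \<open>
  In \<open>poisson_cluster_process M \<nu> I X C M0 C0\<close>, \<open>X 0, X 1, \<dots>\<close> is a measurable enumeration without
  repetitions of the points of the immigrant process \<open>I\<close>, and \<open>C i\<close> is the cluster generated
  by \<open>X i\<close>. The process \<open>C0\<close>, which may live on a different probability space \<open>M0\<close>, represents the
  common law of the centered clusters. Independence of the clusters from \<open>I\<close> is independence of the
  whole sequence of centered clusters from the whole sequence \<open>X\<close>: independence from the set \<open>I\<close> alone
  would still permit the order of the enumeration to depend on the clusters. Library independence of
  two random variables needs equal value types, so it is stated for the generated sigma-algebras.
\<close>

definition poisson_cluster_process ::
  "'w measure \<Rightarrow> real \<Rightarrow> ('w \<Rightarrow> 'a::euclidean_space set) \<Rightarrow> (nat \<Rightarrow> 'w \<Rightarrow> 'a) \<Rightarrow>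
   (nat \<Rightarrow> 'w \<Rightarrow> 'a set) \<Rightarrow> 'c measure \<Rightarrow> ('c \<Rightarrow> 'a set) \<Rightarrow> bool" where
  "poisson_cluster_process M \<nu> I X C M0 C0 \<longleftrightarrow>
     homogeneous_poisson_process M \<nu> I \<and>
     (\<forall>i. X i \<in> borel_measurable M) \<and>
     (AE \<omega> in M. inj (\<lambda>i. X i \<omega>) \<and> I \<omega> = range (\<lambda>i. X i \<omega>)) \<and>
     (\<forall>i. finite_point_process M (C i) \<and> (\<forall>\<omega>\<in>space M. X i \<omega> \<in> C i \<omega>)) \<and>
     finite_point_process M0 C0 \<and> (\<forall>\<omega>\<in>space M0. 0 \<in> C0 \<omega>) \<and>
     prob_space.indep_vars M (\<lambda>_. configurations) (centered_cluster X C) UNIV \<and>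
     (\<forall>i. distr M configurations (centered_cluster X C i) = distr M0 configurations C0) \<and>
     prob_space.indep_set M
       (sets (vimage_algebra (space M) (\<lambda>\<omega> i. X i \<omega>) (PiM UNIV (\<lambda>_. borel))))
       (sets (vimage_algebra (space M) (\<lambda>\<omega> i. centered_cluster X C i \<omega>)
          (PiM UNIV (\<lambda>_. configurations))))"

definition all_clusters :: "(nat \<Rightarrow> 'w \<Rightarrow> 'a set) \<Rightarrow> 'w \<Rightarrow> 'a set" where
  "all_clusters C \<omega> = (\<Union>i. C i \<omega>)"

definition cluster_radius :: "'a::euclidean_space set \<Rightarrow> real" where
  "cluster_radius \<phi> = (SUP y\<in>\<phi>. norm y)"

definition void_probability :: "'w measure \<Rightarrow> ('w \<Rightarrow> 'a::euclidean_space set) \<Rightarrow> real \<Rightarrow> real" where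
  "void_probability M \<Xi> r = measure M {\<omega> \<in> space M. num_points (\<Xi> \<omega>) (cball 0 r) = 0}"

end

theory Submission
  imports Defs
begin

text \<open>
  Every cluster contains its center, so the void probability is at most the probability
  \<open>exp (- \<nu> \<kappa> r^d)\<close> that no immigrant lies in the ball, where \<open>\<kappa>\<close> is the volume of the unit ball.
  Conversely, the ball is empty if each cluster radius, rounded up to an integer \<open>K i\<close>, is less than
  \<open>norm (X i) - r\<close>, that is, less than the index of the unit-width shell around the ball which
  contains \<open>X i\<close>. Given the immigrants, this has probability \<open>\<Prod>i. G (N i)\<close> with
  \<open>N i\<close> that index and \<open>G n = P(K < n)\<close>; grouped by shells, whose counts are independent and Poisson,
  its expectation is \<open>exp (- \<nu> (\<Sum>n. vol (shell n) * P(K \<ge> n))) = exp (- \<nu> \<kappa> E[(r + K)^d])\<close>,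
  and \<open>E[(r + K)^d] / r^d\<close> tends to 1 by dominated convergence.
\<close>

section \<open>Measurability of point counts\<close>

lemma space_configurations: "space configurations = {\<phi>. locally_finite \<phi>}"
  unfolding configurations_def by (rule space_measure_of) auto

lemma measurable_num_points:
  assumes "B \<in> sets borel"
  shows "(\<lambda>\<phi>. num_points \<phi> B) \<in> measurable configurations (count_space UNIV)"
proof -
  have "(\<lambda>\<phi>. num_points \<phi> B) -` {n} \<inter> space configurations \<in> sets configurations" for n
  proof -
    have "(\<lambda>\<phi>. num_points \<phi> B) -` {n} \<inter> space configurations =
        {\<phi>. locally_finite \<phi> \<and> num_points \<phi> B = n}"
      by (auto simp: space_configurations)
    also have "\<dots> \<in> sets configurations"
      unfolding configurations_def using assms by (subst sets_measure_of) blast+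
    finally show ?thesis .
  qed
  then show ?thesis
    by (subst measurable_count_space_eq_countable) auto
qed

lemma num_points_eq_0_iff: "num_points \<phi> B = 0 \<longleftrightarrow> \<phi> \<inter> B = {}"
  by (auto simp: num_points_def zero_enat_def)

section \<open>Integer cluster reach\<close>

text \<open>For a cluster, this is the radius rounded up to an integer. It is phrased through counts
  because those generate the sigma-algebra of configurations.\<close>

definition reach :: "'a::euclidean_space set \<Rightarrow> nat" where
  "reach \<phi> = (LEAST n. num_points \<phi> (- cball 0 (real n)) = 0)"

lemma measurable_reach: "reach \<in> measurable configurations (count_space UNIV)"
proof -
  have "(\<lambda>\<phi>::'a set. num_points \<phi> (- cball 0 (real n)) = 0)
      \<in> measurable configurations (count_space UNIV)" for n
    using measurable_num_points[of "- cball (0::'a) (real n)"]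
    by (auto intro: measurable_compose[where g = "\<lambda>x. x = 0"])
  then show ?thesis
    unfolding reach_def[abs_def] by (intro measurable_Least)
qed

text \<open>Finiteness supplies an integer that bounds all norms, so the \<open>LEAST\<close> is
  attained.\<close>

lemma norm_le_reach:
  assumes "finite \<phi>" "y \<in> \<phi>"
  shows "norm y \<le> real (reach \<phi>)"
proof -
  obtain n :: nat where n: "Max (norm ` \<phi>) \<le> real n"
    using real_arch_simple by blast
  have "norm z \<le> real n" if "z \<in> \<phi>" for z
    using that assms n by (meson Max_ge finite_imageI image_eqI order_trans)
  then have "num_points \<phi> (- cball 0 (real n)) = 0"
    by (auto simp: num_points_eq_0_iff)
  then have "num_points \<phi> (- cball 0 (real (reach \<phi>))) = 0"
    unfolding reach_def by (rule LeastI)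
  then show ?thesis
    using assms(2) by (auto simp: num_points_eq_0_iff disjoint_iff)
qed

text \<open>Transfers moments of the radius to \<open>reach\<close>. The point 0 keeps the supremum
  nonnegative, so rounding up adds at most 1.\<close>

lemma reach_le_cluster_radius:
  assumes "finite \<phi>" "0 \<in> \<phi>"
  shows "0 \<le> cluster_radius \<phi>" "real (reach \<phi>) \<le> cluster_radius \<phi> + 1"
proof -
  have le: "norm y \<le> cluster_radius \<phi>" if "y \<in> \<phi>" for y
    unfolding cluster_radius_def using that assms(1) by (intro cSUP_upper) auto
  show nonneg: "0 \<le> cluster_radius \<phi>"
    using le[OF assms(2)] by simp
  let ?n = "nat \<lceil>cluster_radius \<phi>\<rceil>"
  have "cluster_radius \<phi> \<le> real ?n"
    by (rule of_nat_ceiling)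
  then have "num_points \<phi> (- cball 0 (real ?n)) = 0"
    using le by (fastforce simp: num_points_eq_0_iff)
  then have "reach \<phi> \<le> ?n"
    unfolding reach_def by (rule Least_le)
  moreover have "real ?n \<le> cluster_radius \<phi> + 1"
    using nonneg by linarith
  ultimately show "real (reach \<phi>) \<le> cluster_radius \<phi> + 1"
    by linarith
qed

section \<open>Shells around the ball\<close>

text \<open>Shell 0 is the whole ball, since \<open>nat\<close> truncates negative values.\<close>

definition shell :: "real \<Rightarrow> nat \<Rightarrow> 'a::euclidean_space set" where
  "shell r n = {x. nat \<lceil>norm x - r\<rceil> = n}"

text \<open>For \<open>n\<close> at least 1 a shell is the half-open annulus
  \<open>r + n - 1 < norm x \<le> r + n\<close>, so consecutive shells fill a closed ball
  exactly.\<close>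

lemma UN_shell: "(\<Union>n\<le>k. shell r n) = cball 0 (r + real k)"
  by (auto simp: shell_def nat_le_iff ceiling_le_iff algebra_simps)

lemma shell_subset_cball: "shell r n \<subseteq> cball 0 (r + real n)"
  using UN_shell[of r n] by blast

lemma bounded_shell: "bounded (shell r n)"
  using shell_subset_cball bounded_cball bounded_subset by blast

lemma sets_shell [measurable]: "shell r n \<in> sets borel"
  unfolding shell_def by measurable

lemma shell_nonempty:
  assumes "r \<ge> 0"
  shows "shell r n \<noteq> ({} :: 'a::euclidean_space set)"
proof -
  obtain b :: 'a where "b \<in> Basis"
    using nonempty_Basis by blast
  then have "(r + real n) *\<^sub>R b \<in> shell r n"
    using assms by (simp add: shell_def)
  then show ?thesis by blast
qed

lemma shell_disjoint: "m \<noteq> n \<Longrightarrow> shell r m \<inter> shell r n = {}"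
  by (auto simp: shell_def)

text \<open>The independence clause of the Poisson process is indexed by the sets themselves.
  Injectivity allows these indices to be replaced by \<open>n\<close>; two disjoint shells could
  coincide only if empty.\<close>

lemma inj_shell:
  assumes "r \<ge> 0"
  shows "inj (shell r :: nat \<Rightarrow> 'a::euclidean_space set)"
  by (rule injI) (metis assms inf.idem shell_disjoint shell_nonempty)

lemma sum_measure_shell:
  assumes "r \<ge> 0"
  shows "(\<Sum>n\<le>k. measure lborel (shell r n :: 'a::euclidean_space set)) =
    unit_ball_vol (real DIM('a)) * (r + real k) ^ DIM('a)"
proof -
  have fm: "(shell r n :: 'a set) \<in> fmeasurable lborel" for n
    using emeasure_bounded_finite[OF bounded_shell[of r n]] by (intro fmeasurableI) (auto simp: less_top)
  have "(\<Sum>n\<le>k. measure lborel (shell r n :: 'a set)) = measure lborel (\<Union>n\<le>k. shell r n :: 'a set)"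
    by (rule measure_UNION'[symmetric])
       (auto simp: fm pairwise_def disjnt_def shell_disjoint)
  then show ?thesis
    using assms by (simp add: UN_shell content_cball)
qed

section \<open>Poisson generating functions on shells\<close>

text \<open>The probability generating function of a Poisson variable: weighting the masses by
  \<open>g ^ k\<close> gives the exponential series at \<open>g * l\<close>. Nonnegative integrals
  let sum and integral be exchanged without an integrability check.\<close>

lemma (in prob_space) expectation_power_poisson:
  fixes c :: "'a \<Rightarrow> nat"
  assumes c: "c \<in> measurable M (count_space UNIV)"
    and pois: "\<And>k. measure M {\<omega> \<in> space M. c \<omega> = k} = l ^ k / fact k * exp (- l)"
    and "0 \<le> g" "0 \<le> l"
  shows "(\<integral>\<omega>. g ^ c \<omega> \<partial>M) = exp (- (l * (1 - g)))"
proof -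
  have "(\<integral>\<^sup>+\<omega>. ennreal (g ^ c \<omega>) \<partial>M) =
      (\<integral>\<^sup>+\<omega>. (\<Sum>k. ennreal (g ^ k) * indicator {\<omega> \<in> space M. c \<omega> = k} \<omega>) \<partial>M)"
  proof (rule nn_integral_cong)
    fix \<omega> assume "\<omega> \<in> space M"
    then have "(\<lambda>k. ennreal (g ^ k) * indicator {\<omega> \<in> space M. c \<omega> = k} \<omega>) sums
       ennreal (g ^ c \<omega>)"
      by (intro sums_cong[THEN iffD1, OF _ sums_single[of "c \<omega>" "\<lambda>k. ennreal (g ^ k)"]])
         (auto split: split_indicator)
    then show "ennreal (g ^ c \<omega>) = (\<Sum>k. ennreal (g ^ k) * indicator {\<omega> \<in> space M. c \<omega> = k} \<omega>)"
      by (simp add: sums_iff)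
  qed
  also have "\<dots> = (\<Sum>k. ennreal (g ^ k) * emeasure M {\<omega> \<in> space M. c \<omega> = k})"
    using c by (subst nn_integral_suminf) (auto intro!: suminf_cong nn_integral_cmult_indicator)
  also have "\<dots> = (\<Sum>k. ennreal (exp (- l) * ((g * l) ^ k /\<^sub>R fact k)))"
    by (intro suminf_cong)
       (simp add: emeasure_eq_measure pois assms ennreal_mult' [symmetric] power_mult_distrib
         field_simps)
  also have "\<dots> = ennreal (exp (- l) * exp (g * l))"
    using assms sums_mult[OF exp_converges, of "exp (- l)" "g * l"]
    by (intro suminf_ennreal_eq) auto
  also have "exp (- l) * exp (g * l) = exp (- (l * (1 - g)))"
    by (simp add: exp_add[symmetric] algebra_simps)
  finally show ?thesis
    using assms by (subst integral_eq_nn_integral) auto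
qed

lemma
  fixes I :: "'w \<Rightarrow> 'a::euclidean_space set"
  assumes I: "I \<in> measurable M configurations"
  shows num_points_shell: "\<omega> \<in> space M \<Longrightarrow> num_points (I \<omega>) (shell r n) = enat (card (I \<omega> \<inter> shell r n))"
    and measurable_card_shell: "(\<lambda>\<omega>. card (I \<omega> \<inter> shell r n)) \<in> measurable M (count_space UNIV)"
proof -
  show num: "num_points (I \<omega>) (shell r n) = enat (card (I \<omega> \<inter> shell r n))" if "\<omega> \<in> space M" for \<omega>
    using measurable_space[OF I that] bounded_shell[where 'a='a, of r n]
    by (simp add: space_configurations locally_finite_def num_points_def)
  have "(\<lambda>\<omega>. the_enat (num_points (I \<omega>) (shell r n))) \<in> measurable M (count_space UNIV)"
    using measurable_compose[OF I measurable_num_points[OF sets_shell]]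
    by (rule measurable_compose) simp
  then show "(\<lambda>\<omega>. card (I \<omega> \<inter> shell r n)) \<in> measurable M (count_space UNIV)"
    by (rule measurable_cong[THEN iffD1, rotated]) (simp add: num)
qed

text \<open>Counts in disjoint shells are independent, so the expectation factorizes. Each factor is
  a Poisson generating function at \<open>G n\<close>, and the exponents add up.\<close>

lemma expectation_prod_shells:
  fixes I :: "'w \<Rightarrow> 'a::euclidean_space set"
  assumes I: "homogeneous_poisson_process M \<nu> I"
    and "0 \<le> \<nu>" "0 \<le> r" and G: "\<And>n. 0 \<le> G n" "\<And>n. G n \<le> 1"
  shows "(\<integral>\<omega>. (\<Prod>n\<le>T. G n ^ card (I \<omega> \<inter> shell r n)) \<partial>M) =
    exp (- (\<nu> * (\<Sum>n\<le>T. measure lborel (shell r n :: 'a set) * (1 - G n))))"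
proof -
  interpret prob_space M
    using I by (simp add: homogeneous_poisson_process_def point_process_def)
  have I_meas: "I \<in> measurable M configurations"
    using I by (simp add: homogeneous_poisson_process_def point_process_def)
  \<comment> \<open>Indexed by sets, as in the independence clause. On shells
    \<open>the_enat\<close> loses nothing, since the counts there are finite.\<close>
  define c where "c B \<omega> = the_enat (num_points (I \<omega>) B)" for B \<omega>
  have c: "num_points (I \<omega>) (shell r n) = enat (c (shell r n) \<omega>)" "card (I \<omega> \<inter> shell r n) = c (shell r n) \<omega>"
    if "\<omega> \<in> space M" for \<omega> n
    using num_points_shell[OF I_meas that] by (simp_all add: c_def)
  have meas: "c (shell r n) \<in> measurable M (count_space UNIV)" for n
    unfolding c_def
    using measurable_compose[OF I_meas measurable_num_points[OF sets_shell]]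
    by (rule measurable_compose) simp
  have inj: "inj (shell r :: nat \<Rightarrow> 'a set)"
    using \<open>0 \<le> r\<close> by (rule inj_shell)
  have "disjoint (shell r ` {..T} :: 'a set set)"
    by (auto simp: disjoint_def shell_def)
  then have "indep_vars (\<lambda>_. count_space UNIV) (\<lambda>B \<omega>. num_points (I \<omega>) B) (shell r ` {..T})"
    using I by (auto simp: homogeneous_poisson_process_def bounded_shell)
  \<comment> \<open>The weight depends on the shell number, which \<open>the_inv\<close> recovers
    from the shell.\<close>
  then have "indep_vars (\<lambda>_. borel) (\<lambda>B \<omega>. G (the_inv (shell r) B) ^ c B \<omega>) (shell r ` {..T})"
    unfolding c_def by (rule indep_vars_compose2) simp
  then have "(\<integral>\<omega>. (\<Prod>B\<in>shell r ` {..T}. G (the_inv (shell r) B) ^ c B \<omega>) \<partial>M) =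
      (\<Prod>B\<in>shell r ` {..T}. \<integral>\<omega>. G (the_inv (shell r) B) ^ c B \<omega> \<partial>M)"
    using G by (intro indep_vars_lebesgue_integral)
       (auto intro!: integrable_const_bound[where B = 1] power_le_one
          measurable_compose[OF meas] simp: abs_le_iff power_le_one)
  moreover have "inj_on (shell r :: nat \<Rightarrow> 'a set) {..T}"
    using inj by (rule inj_on_subset) simp
  ultimately have "(\<integral>\<omega>. (\<Prod>n\<le>T. G n ^ c (shell r n) \<omega>) \<partial>M) = (\<Prod>n\<le>T. \<integral>\<omega>. G n ^ c (shell r n) \<omega> \<partial>M)"
    using inj by (simp add: prod.reindex the_inv_f_f)
  also have "\<dots> = (\<Prod>n\<le>T. exp (- (\<nu> * measure lborel (shell r n :: 'a set) * (1 - G n))))"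
  proof (rule prod.cong[OF refl], rule expectation_power_poisson[OF meas])
    fix n k
    have "{\<omega> \<in> space M. c (shell r n) \<omega> = k} =
        {\<omega> \<in> space M. num_points (I \<omega>) (shell r n) = enat k}"
      by (auto simp: c)
    then show "prob {\<omega> \<in> space M. c (shell r n) \<omega> = k} =
        (\<nu> * measure lborel (shell r n :: 'a set)) ^ k / fact k * exp (- (\<nu> * measure lborel (shell r n :: 'a set)))"
      using I bounded_shell[where 'a='a, of r n] by (simp add: homogeneous_poisson_process_def)
  qed (use G \<open>0 \<le> \<nu>\<close> in auto)
  also have "\<dots> = exp (- (\<nu> * (\<Sum>n\<le>T. measure lborel (shell r n :: 'a set) * (1 - G n))))"
    by (simp add: exp_sum[symmetric] sum_distrib_left sum_negf mult.assoc)
  finally show ?thesis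
    by (simp add: c cong: Bochner_Integration.integral_cong)
qed

section \<open>Termwise comparison of independent sequences\<close>

text \<open>Conditioning on \<open>N\<close> by Fubini: for fixed thresholds the independence of the
  \<open>K i\<close> gives a product, which is then integrated over the law of \<open>N\<close>. The
  entries of \<open>N\<close> may depend on each other.\<close>

lemma (in prob_space) prob_less_indep_sequences:
  fixes N K :: "nat \<Rightarrow> 'a \<Rightarrow> nat"
  defines "P \<equiv> PiM UNIV (\<lambda>_::nat. count_space (UNIV::nat set))"
  assumes NK: "indep_var P (\<lambda>\<omega> i. N i \<omega>) P (\<lambda>\<omega> i. K i \<omega>)"
    and K: "indep_vars (\<lambda>_. count_space UNIV) K UNIV"
    and G: "\<And>i n. prob {\<omega> \<in> space M. K i \<omega> < n} = G n"
  shows "prob {\<omega> \<in> space M. \<forall>i<m. K i \<omega> < N i \<omega>} = (\<integral>\<omega>. (\<Prod>i<m. G (N i \<omega>)) \<partial>M)"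
proof -
  have N_meas: "(\<lambda>\<omega> i. N i \<omega>) \<in> measurable M P" and K_meas: "(\<lambda>\<omega> i. K i \<omega>) \<in> measurable M P"
    using NK by (auto simp: indep_var_eq)
  have Ki: "K i \<in> measurable M (count_space UNIV)" for i
    using K by (simp add: indep_vars_def)
  have Ni: "N i \<in> measurable M (count_space UNIV)" for i
    using measurable_compose[OF N_meas, of "\<lambda>f. f i"] by (simp add: P_def)
  interpret D: prob_space "distr M P (\<lambda>\<omega> i. K i \<omega>)"
    by (rule prob_space_distr) fact
  have prod: "prob {\<omega> \<in> space M. \<forall>i<m. K i \<omega> < n i} = (\<Prod>i<m. G (n i))" for n
  \<comment> \<open>The product rule for independent variables wants a nonempty index set; for
    \<open>m = 0\<close> both sides are 1.\<close>
  proof (cases "m = 0")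
    case False
    have "prob (\<Inter>i\<in>{..<m}. K i -` {..<n i} \<inter> space M) =
        (\<Prod>i<m. prob (K i -` {..<n i} \<inter> space M))"
      using False by (intro indep_varsD[OF K]) auto
    moreover have "(\<Inter>i\<in>{..<m}. K i -` {..<n i} \<inter> space M) = {\<omega> \<in> space M. \<forall>i<m. K i \<omega> < n i}"
      using False by auto
    moreover have "K i -` {..<n i} \<inter> space M = {\<omega> \<in> space M. K i \<omega> < n i}" for i
      by auto
    ultimately show ?thesis by (simp add: G)
  qed (simp add: prob_space)
  define S where "S = {z \<in> space (P \<Otimes>\<^sub>M P). \<forall>i\<in>{..<m}. real (snd z i) < real (fst z i)}"
  have S: "S \<in> sets (P \<Otimes>\<^sub>M P)"
  proof -
    have [measurable]: "(\<lambda>f. real (f i)) \<in> borel_measurable P" for i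
      unfolding P_def by (rule measurable_compose[OF measurable_component_singleton]) auto
    show ?thesis
      unfolding S_def by measurable
  qed
  have "emeasure M {\<omega> \<in> space M. \<forall>i<m. K i \<omega> < N i \<omega>} =
      emeasure (distr M (P \<Otimes>\<^sub>M P) (\<lambda>\<omega>. (\<lambda>i. N i \<omega>, \<lambda>i. K i \<omega>))) S"
    using N_meas K_meas S
    by (subst emeasure_distr) (auto intro!: arg_cong[where f = "emeasure M"]
      simp: S_def space_pair_measure dest: measurable_space)
  \<comment> \<open>Independence makes the joint law a product measure, whose mass on
    \<open>S\<close> is the integral of the masses of its slices.\<close>
  also have "\<dots> = (\<integral>\<^sup>+n. emeasure (distr M P (\<lambda>\<omega> i. K i \<omega>)) (Pair n -` S) \<partial>distr M P (\<lambda>\<omega> i. N i \<omega>))"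
    using NK S by (simp add: indep_var_distribution_eq[THEN iffD1, OF NK, THEN conjunct2, THEN conjunct2, symmetric]
        D.emeasure_pair_measure_alt)
  also have "\<dots> = (\<integral>\<^sup>+\<omega>. emeasure (distr M P (\<lambda>\<omega> i. K i \<omega>)) (Pair (\<lambda>i. N i \<omega>) -` S) \<partial>M)"
    using N_meas S by (intro nn_integral_distr) (auto intro!: D.measurable_emeasure_Pair)
  also have "\<dots> = (\<integral>\<^sup>+\<omega>. ennreal (\<Prod>i<m. G (N i \<omega>)) \<partial>M)"
  proof (rule nn_integral_cong)
    fix \<omega> assume "\<omega> \<in> space M"
    have "(\<lambda>\<omega> i. K i \<omega>) -` (Pair (\<lambda>i. N i \<omega>) -` S) \<inter> space M = {\<omega>' \<in> space M. \<forall>i<m. K i \<omega>' < N i \<omega>}"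
      by (auto simp: S_def P_def space_pair_measure space_PiM)
    then show "emeasure (distr M P (\<lambda>\<omega> i. K i \<omega>)) (Pair (\<lambda>i. N i \<omega>) -` S) = ennreal (\<Prod>i<m. G (N i \<omega>))"
      using K_meas S by (simp add: emeasure_distr sets_Pair1 emeasure_eq_measure prod)
  qed
  finally have "(\<integral>\<^sup>+\<omega>. ennreal (\<Prod>i<m. G (N i \<omega>)) \<partial>M) =
      ennreal (prob {\<omega> \<in> space M. \<forall>i<m. K i \<omega> < N i \<omega>})"
    by (simp add: emeasure_eq_measure)
  moreover have "0 \<le> G n" for n
    using G[of 0 n] measure_nonneg by metis
  ultimately show ?thesis
    by (subst integral_eq_nn_integral)
       (auto intro!: borel_measurable_prod measurable_compose[OF Ni] prod_nonneg)
qed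

section \<open>Shell estimates for products and tail sums\<close>

text \<open>
  The points outside the first \<open>T\<close> shells contribute at least \<open>G (Suc T) ^ m\<close>, which tends to 1
  as \<open>T\<close> grows, so finitely many shell counts suffice for the lower bound.
\<close>

lemma prod_shell_index_ge:
  fixes x :: "nat \<Rightarrow> 'a::euclidean_space"
  assumes G: "mono G" "\<And>n. 0 \<le> G n" "\<And>n. G n \<le> (1::real)"
    and x: "inj x" and fin: "\<And>n. finite (range x \<inter> shell r n)"
  shows "G (Suc T) ^ m * (\<Prod>n\<le>T. G n ^ card (range x \<inter> shell r n)) \<le>
    (\<Prod>i<m. G (nat \<lceil>norm (x i) - r\<rceil>))"
proof -
  define j where "j i = nat \<lceil>norm (x i) - r\<rceil>" for i
  define A where "A = {i\<in>{..<m}. j i \<le> T}"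
  \<comment> \<open>Outside \<open>A\<close> the shell index is at least \<open>Suc T\<close>, so
    monotonicity bounds each factor below; there are at most \<open>m\<close> of them and the base
    is at most 1.\<close>
  have "G (Suc T) ^ m \<le> G (Suc T) ^ card ({..<m} - A)"
    using G by (intro power_decreasing) (auto intro: order_trans[OF card_mono[of "{..<m}"]])
  also have "\<dots> \<le> (\<Prod>i\<in>{..<m} - A. G (j i))"
    unfolding prod_constant[symmetric] using G by (intro prod_mono) (auto simp: A_def intro: monoD)
  finally have far: "G (Suc T) ^ m \<le> (\<Prod>i\<in>{..<m} - A. G (j i))" .
  \<comment> \<open>The first \<open>m\<close> points put no more points in a shell than the whole
    sequence does; with a base at most 1, the smaller exponent gives the larger power.\<close>
  have "(\<Prod>n\<le>T. G n ^ card (range x \<inter> shell r n)) \<le> (\<Prod>n\<le>T. G n ^ card {i\<in>A. j i = n})"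
  proof (intro prod_mono conjI power_decreasing)
    fix n
    have "card {i\<in>A. j i = n} = card (x ` {i\<in>A. j i = n})"
      using x by (intro card_image[symmetric]) (auto simp: inj_on_def)
    also have "\<dots> \<le> card (range x \<inter> shell r n)"
      using fin by (intro card_mono) (auto simp: shell_def j_def)
    finally show "card {i\<in>A. j i = n} \<le> card (range x \<inter> shell r n)" .
  qed (use G in auto)
  also have "\<dots> = (\<Prod>n\<le>T. \<Prod>i\<in>{i\<in>A. j i = n}. G (j i))"
    by simp
  also have "\<dots> = (\<Prod>i\<in>A. G (j i))"
    by (rule prod.group) (auto simp: A_def)
  finally have near: "(\<Prod>n\<le>T. G n ^ card (range x \<inter> shell r n)) \<le> (\<Prod>i\<in>A. G (j i))" .
  have "(\<Prod>i<m. G (j i)) = (\<Prod>i\<in>{..<m} - A. G (j i)) * (\<Prod>i\<in>A. G (j i))"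
    by (rule prod.subset_diff) (auto simp: A_def)
  then show ?thesis
    using mult_mono[OF far near] G by (simp add: j_def prod_nonneg)
qed

text \<open>The shells with \<open>n \<le> K\<close> fill the ball of radius \<open>r + K\<close>,
  so exchanging sum and expectation turns the tails \<open>P(K \<ge> n)\<close> into a moment.
  Truncation at \<open>T\<close> only drops nonnegative terms.\<close>

lemma (in prob_space) sum_shell_tail_le:
  fixes K :: "'a \<Rightarrow> nat"
  assumes K: "K \<in> measurable M (count_space UNIV)"
    and int: "integrable M (\<lambda>\<omega>. (r + real (K \<omega>)) ^ DIM('b::euclidean_space))" and "0 \<le> r"
  shows "(\<Sum>n\<le>T. measure lborel (shell r n :: 'b set) * (1 - prob {\<omega> \<in> space M. K \<omega> < n})) \<le>
    unit_ball_vol (real DIM('b)) * (\<integral>\<omega>. (r + real (K \<omega>)) ^ DIM('b) \<partial>M)"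
proof -
  let ?v = "\<lambda>n. measure lborel (shell r n :: 'b set)"
  have E: "{\<omega> \<in> space M. n \<le> K \<omega>} \<in> events" for n
    using measurable_sets[OF K, of "{n..}"] by (simp add: vimage_def Int_def conj_commute)
  have "1 - prob {\<omega> \<in> space M. K \<omega> < n} = prob {\<omega> \<in> space M. n \<le> K \<omega>}" for n
  proof -
    have "{\<omega> \<in> space M. K \<omega> < n} = space M - {\<omega> \<in> space M. n \<le> K \<omega>}" by auto
    then show ?thesis using prob_compl[OF E] by simp
  qed
  then have "(\<Sum>n\<le>T. ?v n * (1 - prob {\<omega> \<in> space M. K \<omega> < n})) =
      (\<Sum>n\<le>T. \<integral>\<omega>. ?v n * indicator {\<omega> \<in> space M. n \<le> K \<omega>} \<omega> \<partial>M)"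
    using E by simp
  also have "\<dots> = (\<integral>\<omega>. (\<Sum>n\<le>T. ?v n * indicator {\<omega> \<in> space M. n \<le> K \<omega>} \<omega>) \<partial>M)"
    using E by (intro Bochner_Integration.integral_sum[symmetric]) (auto simp: less_top[symmetric])
  also have "\<dots> \<le> (\<integral>\<omega>. unit_ball_vol (real DIM('b)) * (r + real (K \<omega>)) ^ DIM('b) \<partial>M)"
  proof (rule integral_mono)
    fix \<omega> assume "\<omega> \<in> space M"
    then have "(\<Sum>n\<le>T. ?v n * indicator {\<omega> \<in> space M. n \<le> K \<omega>} \<omega>) = (\<Sum>n | n \<le> T \<and> n \<le> K \<omega>. ?v n)"
      by (auto simp: indicator_def sum.If_cases if_distrib Int_def cong: if_cong)
    also have "\<dots> \<le> (\<Sum>n\<le>K \<omega>. ?v n)"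
      by (intro sum_mono2) auto
    finally show "(\<Sum>n\<le>T. ?v n * indicator {\<omega> \<in> space M. n \<le> K \<omega>} \<omega>) \<le>
        unit_ball_vol (real DIM('b)) * (r + real (K \<omega>)) ^ DIM('b)"
      using \<open>0 \<le> r\<close> by (simp add: sum_measure_shell)
  next
    show "integrable M (\<lambda>\<omega>. \<Sum>n\<le>T. ?v n * indicator {\<omega> \<in> space M. n \<le> K \<omega>} \<omega>)"
      using E by (intro Bochner_Integration.integrable_sum) (simp add: less_top[symmetric])
  qed (use int in simp)
  finally show ?thesis by simp
qed

section \<open>From generated sigma-algebras to independent variables\<close>

text \<open>A measurable function of \<open>f\<close> generates a sub-sigma-algebra of the one
  generated by \<open>f\<close>, and independence passes to sub-sigma-algebras. This carries the
  independence of immigrants and centered clusters over to the sequences of shell indices and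
  reaches.\<close>

lemma (in prob_space) indep_var_of_vimage_algebras:
  assumes indep: "indep_set (sets (vimage_algebra (space M) f S)) (sets (vimage_algebra (space M) g T))"
    and f: "f \<in> measurable M S" and g: "g \<in> measurable M T"
    and h: "h \<in> measurable S P" and k: "k \<in> measurable T Q"
  shows "indep_var P (\<lambda>\<omega>. h (f \<omega>)) Q (\<lambda>\<omega>. k (g \<omega>))"
proof -
  have sub: "sigma_sets (space M) {(\<lambda>\<omega>. u (v \<omega>)) -` A \<inter> space M |A. A \<in> sets Y} \<subseteq>
      sets (vimage_algebra (space M) v Z)"
    if v: "v \<in> measurable M Z" and u: "u \<in> measurable Z Y"
    for v :: "'a \<Rightarrow> 'x" and Z and u :: "'x \<Rightarrow> 'y" and Y
  proof -
    have "(\<lambda>\<omega>. u (v \<omega>)) \<in> measurable (vimage_algebra (space M) v Z) Y"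
      using v by (intro measurable_compose[OF _ u] measurable_vimage_algebra1) (auto dest: measurable_space)
    from measurable_sets[OF this]
    have "{(\<lambda>\<omega>. u (v \<omega>)) -` A \<inter> space M |A. A \<in> sets Y} \<subseteq> sets (vimage_algebra (space M) v Z)"
      by auto
    from sets.sigma_sets_subset[OF this] show ?thesis by simp
  qed
  have "indep_set (sigma_sets (space M) {(\<lambda>\<omega>. h (f \<omega>)) -` A \<inter> space M |A. A \<in> sets P})
      (sigma_sets (space M) {(\<lambda>\<omega>. k (g \<omega>)) -` A \<inter> space M |A. A \<in> sets Q})"
    using sub[OF f h] sub[OF g k] indep unfolding indep_sets2_eq by blast
  then show ?thesis
    using measurable_compose[OF f h] measurable_compose[OF g k] by (simp add: indep_var_eq)
qed

section \<open>Measurability and moments for the cluster process\<close>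

context
  fixes M :: "'w measure" and M0 :: "'c measure" and \<nu> :: real
    and I :: "'w \<Rightarrow> 'a::euclidean_space set" and X :: "nat \<Rightarrow> 'w \<Rightarrow> 'a"
    and C :: "nat \<Rightarrow> 'w \<Rightarrow> 'a set" and C0 :: "'c \<Rightarrow> 'a set"
  assumes pcp: "poisson_cluster_process M \<nu> I X C M0 C0"
begin

interpretation M: prob_space M
  using pcp by (simp add: poisson_cluster_process_def homogeneous_poisson_process_def point_process_def)

interpretation M0: prob_space M0
  using pcp by (simp add: poisson_cluster_process_def finite_point_process_def point_process_def)

lemma poisson_immigrants: "homogeneous_poisson_process M \<nu> I"
  using pcp by (simp add: poisson_cluster_process_def)

lemma measurable_immigrants: "I \<in> measurable M configurations"
  using poisson_immigrants by (simp add: homogeneous_poisson_process_def point_process_def)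

lemma measurable_reach_C0: "(\<lambda>\<omega>. reach (C0 \<omega>)) \<in> measurable M0 (count_space UNIV)"
  using pcp measurable_compose[OF _ measurable_reach]
  by (auto simp: poisson_cluster_process_def finite_point_process_def point_process_def)

lemma reach_C0_bounds:
  assumes "\<omega> \<in> space M0"
  shows "0 \<le> cluster_radius (C0 \<omega>)" "real (reach (C0 \<omega>)) \<le> cluster_radius (C0 \<omega>) + 1"
  using pcp assms reach_le_cluster_radius[of "C0 \<omega>"]
  by (auto simp: poisson_cluster_process_def finite_point_process_def)

lemma integrable_reach_power:
  assumes L: "integrable M0 (\<lambda>\<omega>. cluster_radius (C0 \<omega>) ^ d)" and "0 \<le> r"
  shows "integrable M0 (\<lambda>\<omega>. (r + real (reach (C0 \<omega>))) ^ d)"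
proof (rule Bochner_Integration.integrable_bound)
  show "integrable M0 (\<lambda>\<omega>. 2 ^ d * ((r + 1) ^ d + cluster_radius (C0 \<omega>) ^ d))"
    using L by simp
  show "(\<lambda>\<omega>. (r + real (reach (C0 \<omega>))) ^ d) \<in> borel_measurable M0"
    using measurable_reach_C0 by (rule measurable_compose) simp
  show "AE \<omega> in M0. norm ((r + real (reach (C0 \<omega>))) ^ d) \<le>
      norm (2 ^ d * ((r + 1) ^ d + cluster_radius (C0 \<omega>) ^ d))"
  proof (rule AE_I2)
    fix \<omega> assume "\<omega> \<in> space M0"
    note L = reach_C0_bounds[OF this]
    \<comment> \<open>The left side is at most \<open>r + 1\<close> plus the radius, hence at most
      twice the larger of the two. The power of a maximum of nonnegative numbers is at most the sum
      of their powers.\<close>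
    have "r + real (reach (C0 \<omega>)) \<le> 2 * max (r + 1) (cluster_radius (C0 \<omega>))"
      using L(2) unfolding max_def by (cases "r + 1 \<le> cluster_radius (C0 \<omega>)") simp_all
    then have "(r + real (reach (C0 \<omega>))) ^ d \<le> (2 * max (r + 1) (cluster_radius (C0 \<omega>))) ^ d"
      using \<open>0 \<le> r\<close> by (intro power_mono) auto
    also have "\<dots> = 2 ^ d * max (r + 1) (cluster_radius (C0 \<omega>)) ^ d"
      by (simp add: power_mult_distrib)
    also have "\<dots> \<le> 2 ^ d * ((r + 1) ^ d + cluster_radius (C0 \<omega>) ^ d)"
      using L \<open>0 \<le> r\<close> by (intro mult_left_mono) (auto simp: max_def)
    finally show "norm ((r + real (reach (C0 \<omega>))) ^ d) \<le>
        norm (2 ^ d * ((r + 1) ^ d + cluster_radius (C0 \<omega>) ^ d))"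
      using L \<open>0 \<le> r\<close> by simp
  qed
qed

lemma void_event_eq:
  "{\<omega> \<in> space M. num_points (all_clusters C \<omega>) B = 0} =
    (\<Inter>i. {\<omega> \<in> space M. num_points (C i \<omega>) B = 0})"
  by (auto simp: num_points_eq_0_iff all_clusters_def)

text \<open>The union of the clusters is not assumed to be a point process, so measurability comes
  from the single clusters through a countable intersection.\<close>

lemma void_event_measurable:
  assumes "B \<in> sets borel"
  shows "{\<omega> \<in> space M. num_points (all_clusters C \<omega>) B = 0} \<in> sets M"
proof -
  have "C i \<in> measurable M configurations" for i
    using pcp by (simp add: poisson_cluster_process_def finite_point_process_def point_process_def)
  then have "(\<lambda>\<omega>. num_points (C i \<omega>) B) \<in> measurable M (count_space UNIV)" for i
    using measurable_num_points[OF assms] by (rule measurable_compose)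
  from measurable_sets[OF this, of "{0}"]
  have "{\<omega> \<in> space M. num_points (C i \<omega>) B = 0} \<in> sets M" for i
    by (simp add: vimage_def Int_def conj_commute)
  then show ?thesis
    unfolding void_event_eq by (intro sets.countable_INT') auto
qed

section \<open>Bounds for the void probability\<close>

lemma void_probability_le:
  assumes "0 \<le> r"
  shows "void_probability M (all_clusters C) r \<le>
    exp (- (\<nu> * (unit_ball_vol (real DIM('a)) * r ^ DIM('a))))"
proof -
  have poisson: "M.prob {\<omega> \<in> space M. num_points (I \<omega>) B = enat k} =
      (\<nu> * measure lborel B) ^ k / fact k * exp (- (\<nu> * measure lborel B))"
    if "B \<in> sets borel" "bounded B" for B k
    using poisson_immigrants that by (simp add: homogeneous_poisson_process_def)
  have "void_probability M (all_clusters C) r \<le> M.prob {\<omega> \<in> space M. num_points (I \<omega>) (cball 0 r) = enat 0}"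
    unfolding void_probability_def
  \<comment> \<open>The inclusion of events is only almost sure, because \<open>X\<close> enumerates
    \<open>I\<close> only almost surely.\<close>
  proof (rule M.finite_measure_mono_AE)
    have "AE \<omega> in M. inj (\<lambda>i. X i \<omega>) \<and> I \<omega> = range (\<lambda>i. X i \<omega>)"
      using pcp by (simp add: poisson_cluster_process_def)
    then show "AE \<omega> in M. \<omega> \<in> {\<omega> \<in> space M. num_points (all_clusters C \<omega>) (cball 0 r) = 0} \<longrightarrow>
        \<omega> \<in> {\<omega> \<in> space M. num_points (I \<omega>) (cball 0 r) = enat 0}"
    proof (eventually_elim, intro impI)
      fix \<omega> assume *: "inj (\<lambda>i. X i \<omega>) \<and> I \<omega> = range (\<lambda>i. X i \<omega>)"
        "\<omega> \<in> {\<omega> \<in> space M. num_points (all_clusters C \<omega>) (cball 0 r) = 0}"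
      then have "X i \<omega> \<in> C i \<omega>" for i
        using pcp by (simp add: poisson_cluster_process_def)
      then have "X i \<omega> \<in> all_clusters C \<omega>" for i
        unfolding all_clusters_def by blast
      then show "\<omega> \<in> {\<omega> \<in> space M. num_points (I \<omega>) (cball 0 r) = enat 0}"
        using * by (auto simp: num_points_eq_0_iff zero_enat_def[symmetric])
    qed
    have "(\<lambda>\<omega>. num_points (I \<omega>) (cball 0 r)) \<in> measurable M (count_space UNIV)"
      using measurable_immigrants measurable_num_points by (rule measurable_compose) simp
    from measurable_sets[OF this, of "{enat 0}"]
    show "{\<omega> \<in> space M. num_points (I \<omega>) (cball 0 r) = enat 0} \<in> sets M"
      by (simp add: vimage_def Int_def conj_commute)
  qed
  also have "\<dots> = (\<nu> * measure lborel (cball (0::'a) r)) ^ 0 / fact 0 *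
      exp (- (\<nu> * measure lborel (cball (0::'a) r)))"
    by (rule poisson) auto
  finally show ?thesis
    using assms by (simp add: content_cball)
qed

text \<open>First only \<open>m\<close> clusters and \<open>T\<close> shells are considered. Letting
  \<open>T\<close> grow with \<open>m\<close> fixed removes the factor of the far points; letting
  \<open>m\<close> grow then covers all clusters, as \<open>?b\<close> depends on neither.\<close>

lemma void_probability_ge:
  assumes "0 \<le> \<nu>" "0 \<le> r"
    and int: "integrable M0 (\<lambda>\<omega>. (r + real (reach (C0 \<omega>))) ^ DIM('a))"
  shows "exp (- (\<nu> * (unit_ball_vol (real DIM('a)) * (\<integral>\<omega>. (r + real (reach (C0 \<omega>))) ^ DIM('a) \<partial>M0)))) \<le>
    void_probability M (all_clusters C) r" (is "?b \<le> _")
proof -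
  define N where "N i \<omega> = nat \<lceil>norm (X i \<omega>) - r\<rceil>" for i \<omega>
  define K where "K i \<omega> = reach (centered_cluster X C i \<omega>)" for i \<omega>
  define G where "G n = M0.prob {\<omega> \<in> space M0. reach (C0 \<omega>) < n}" for n
  let ?P = "PiM UNIV (\<lambda>_::nat. count_space (UNIV::nat set))"
  have E0: "{\<omega> \<in> space M0. reach (C0 \<omega>) < n} \<in> sets M0" for n
    using measurable_sets[OF measurable_reach_C0, of "{..<n}"]
    by (simp add: vimage_def Int_def conj_commute)
  have G: "mono G" "\<And>n. 0 \<le> G n" "\<And>n. G n \<le> 1"
    unfolding G_def using E0 by (auto intro!: monoI M0.finite_measure_mono)
  \<comment> \<open>\<open>reach\<close> takes values in \<open>nat\<close>, so the events
    \<open>reach < n\<close> exhaust the space.\<close>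
  have G_lim: "(\<lambda>T. G (Suc T)) \<longlonglongrightarrow> 1"
  proof -
    have "G \<longlonglongrightarrow> M0.prob (\<Union>n. {\<omega> \<in> space M0. reach (C0 \<omega>) < n})"
      unfolding G_def using E0 by (intro M0.finite_Lim_measure_incseq) (auto simp: incseq_def)
    also have "(\<Union>n. {\<omega> \<in> space M0. reach (C0 \<omega>) < n}) = space M0"
      by auto
    finally show ?thesis
      by (simp add: M0.prob_space LIMSEQ_Suc)
  qed
  have indep: "M.indep_vars (\<lambda>_. configurations) (centered_cluster X C) UNIV"
    using pcp by (simp add: poisson_cluster_process_def)
  then have cc: "centered_cluster X C i \<in> measurable M configurations" for i
    by (simp add: M.indep_vars_def)
  have X: "X i \<in> borel_measurable M" for i
    using pcp by (simp add: poisson_cluster_process_def)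
  have indep_K: "M.indep_vars (\<lambda>_. count_space UNIV) K UNIV"
    unfolding K_def using indep measurable_reach by (rule M.indep_vars_compose2)
  \<comment> \<open>\<open>N\<close> is a function of the immigrants alone and \<open>K\<close> of
    the centered clusters alone.\<close>
  have indep_NK: "M.indep_var ?P (\<lambda>\<omega> i. N i \<omega>) ?P (\<lambda>\<omega> i. K i \<omega>)"
    unfolding N_def K_def
  proof (rule M.indep_var_of_vimage_algebras[where h = "\<lambda>x i. nat \<lceil>norm (x i) - r\<rceil>" and k = "\<lambda>y i. reach (y i)"
        and f = "\<lambda>\<omega> i. X i \<omega>" and g = "\<lambda>\<omega> i. centered_cluster X C i \<omega>"])
    show "M.indep_set
        (sets (vimage_algebra (space M) (\<lambda>\<omega> i. X i \<omega>) (PiM UNIV (\<lambda>_. borel))))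
        (sets (vimage_algebra (space M) (\<lambda>\<omega> i. centered_cluster X C i \<omega>) (PiM UNIV (\<lambda>_. configurations))))"
      using pcp by (simp add: poisson_cluster_process_def)
    show "(\<lambda>\<omega> i. X i \<omega>) \<in> measurable M (PiM UNIV (\<lambda>_. borel))"
      using X by (intro measurable_PiM_single') auto
    show "(\<lambda>\<omega> i. centered_cluster X C i \<omega>) \<in> measurable M (PiM UNIV (\<lambda>_. configurations))"
      using cc by (intro measurable_PiM_single') (auto dest: measurable_space)
    show "(\<lambda>x i. nat \<lceil>norm (x i :: 'a) - r\<rceil>) \<in> measurable (PiM UNIV (\<lambda>_. borel)) ?P"
      by (intro measurable_PiM_single') auto
    show "(\<lambda>y i. reach (y i :: 'a set)) \<in> measurable (PiM UNIV (\<lambda>_. configurations)) ?P"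
      by (intro measurable_PiM_single' measurable_compose[OF measurable_component_singleton]) (auto simp: measurable_reach)
  qed
  have law: "M.prob {\<omega> \<in> space M. K i \<omega> < n} = G n" for i n
  proof -
    let ?A = "reach -` {..<n} \<inter> space configurations :: 'a set set"
    have A: "?A \<in> sets configurations"
      using measurable_reach by (rule measurable_sets) simp
    have C0: "C0 \<in> measurable M0 configurations"
      using pcp by (simp add: poisson_cluster_process_def finite_point_process_def point_process_def)
    have "distr M configurations (centered_cluster X C i) = distr M0 configurations C0"
      using pcp by (simp add: poisson_cluster_process_def)
    then have "measure (distr M configurations (centered_cluster X C i)) ?A =
        measure (distr M0 configurations C0) ?A"
      by simp
    moreover have "centered_cluster X C i -` ?A \<inter> space M = {\<omega> \<in> space M. K i \<omega> < n}"
      using measurable_space[OF cc] by (auto simp: K_def)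
    moreover have "C0 -` ?A \<inter> space M0 = {\<omega> \<in> space M0. reach (C0 \<omega>) < n}"
      using measurable_space[OF C0] by auto
    ultimately show ?thesis
      using A cc C0 by (simp add: measure_distr G_def)
  qed
  have N: "N i \<in> measurable M (count_space UNIV)" for i
    unfolding N_def using X by measurable
  have K: "K i \<in> measurable M (count_space UNIV)" for i
    using indep_K by (simp add: M.indep_vars_def)
  let ?B = "\<lambda>m. {\<omega> \<in> space M. \<forall>i<m. K i \<omega> < N i \<omega>}"
  have B: "?B m \<in> sets M" for m
  proof -
    have "{\<omega> \<in> space M. real (K i \<omega>) < real (N i \<omega>)} \<in> sets M" for i
      by (intro borel_measurable_less measurable_compose[OF K] measurable_compose[OF N]) simp_all
    then have "{\<omega> \<in> space M. i < m \<longrightarrow> K i \<omega> < N i \<omega>} \<in> sets M" for i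
      by (cases "i < m") simp_all
    then show ?thesis
      by (rule sets.sets_Collect_countable_All)
  qed
  have lower: "?b \<le> M.prob (?B m)" for m
  proof -
    have "G (Suc T) ^ m * ?b \<le> M.prob (?B m)" for T
    proof -
      have "(\<Sum>n\<le>T. measure lborel (shell r n :: 'a set) * (1 - G n)) \<le>
          unit_ball_vol (real DIM('a)) * (\<integral>\<omega>. (r + real (reach (C0 \<omega>))) ^ DIM('a) \<partial>M0)"
        unfolding G_def using measurable_reach_C0 int \<open>0 \<le> r\<close> by (rule M0.sum_shell_tail_le)
      then have "?b \<le> exp (- (\<nu> * (\<Sum>n\<le>T. measure lborel (shell r n :: 'a set) * (1 - G n))))"
        using \<open>0 \<le> \<nu>\<close> by (simp add: mult_left_mono)
      also have "\<dots> = (\<integral>\<omega>. (\<Prod>n\<le>T. G n ^ card (I \<omega> \<inter> shell r n)) \<partial>M)"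
        using poisson_immigrants assms G by (subst expectation_prod_shells) auto
      finally have "G (Suc T) ^ m * ?b \<le> (\<integral>\<omega>. G (Suc T) ^ m * (\<Prod>n\<le>T. G n ^ card (I \<omega> \<inter> shell r n)) \<partial>M)"
        using G by (simp add: mult_left_mono)
      also have "\<dots> \<le> (\<integral>\<omega>. (\<Prod>i<m. G (N i \<omega>)) \<partial>M)"
      proof (rule integral_mono_AE)
        have "(\<lambda>\<omega>. \<Prod>n\<le>T. G n ^ card (I \<omega> \<inter> shell r n)) \<in> borel_measurable M"
          by (intro borel_measurable_prod measurable_compose[OF measurable_card_shell[OF measurable_immigrants]]) simp
        then have "integrable M (\<lambda>\<omega>. \<Prod>n\<le>T. G n ^ card (I \<omega> \<inter> shell r n))"
          using G by (intro M.integrable_const_bound[where B = 1])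
            (auto simp: abs_le_iff prod_nonneg power_le_one intro!: prod_le_1 AE_I2 order_trans[OF _ prod_nonneg])
        then show "integrable M (\<lambda>\<omega>. G (Suc T) ^ m * (\<Prod>n\<le>T. G n ^ card (I \<omega> \<inter> shell r n)))"
          by simp
        have "(\<lambda>\<omega>. \<Prod>i<m. G (N i \<omega>)) \<in> borel_measurable M"
          by (intro borel_measurable_prod measurable_compose[OF N]) simp
        then show "integrable M (\<lambda>\<omega>. \<Prod>i<m. G (N i \<omega>))"
          using G by (intro M.integrable_const_bound[where B = 1])
            (auto simp: abs_le_iff prod_nonneg intro!: prod_le_1)
        \<comment> \<open>The pointwise comparison of products needs \<open>X\<close> to enumerate
          the points of \<open>I\<close> without repetition.\<close>
        have "AE \<omega> in M. inj (\<lambda>i. X i \<omega>) \<and> I \<omega> = range (\<lambda>i. X i \<omega>)"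
          using pcp by (simp add: poisson_cluster_process_def)
        with AE_space show "AE \<omega> in M. G (Suc T) ^ m * (\<Prod>n\<le>T. G n ^ card (I \<omega> \<inter> shell r n)) \<le> (\<Prod>i<m. G (N i \<omega>))"
        proof eventually_elim
          fix \<omega> assume *: "\<omega> \<in> space M" "inj (\<lambda>i. X i \<omega>) \<and> I \<omega> = range (\<lambda>i. X i \<omega>)"
          have "finite (I \<omega> \<inter> shell r n)" for n
            using measurable_space[OF measurable_immigrants *(1)] bounded_shell
            by (auto simp: space_configurations locally_finite_def)
          then show "G (Suc T) ^ m * (\<Prod>n\<le>T. G n ^ card (I \<omega> \<inter> shell r n)) \<le> (\<Prod>i<m. G (N i \<omega>))"
            using prod_shell_index_ge[OF G, of "\<lambda>i. X i \<omega>" r T m] * by (simp add: N_def)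
        qed
      qed
      also have "\<dots> = M.prob (?B m)"
        using indep_NK indep_K law by (rule M.prob_less_indep_sequences[symmetric])
      finally show ?thesis .
    qed
    \<comment> \<open>With \<open>m\<close> fixed, the power of \<open>G (Suc T)\<close> tends to
      1.\<close>
    moreover have "(\<lambda>T. G (Suc T) ^ m * ?b) \<longlonglongrightarrow> 1 ^ m * ?b"
      by (intro tendsto_mult tendsto_power G_lim tendsto_const)
    ultimately show ?thesis
      by (intro LIMSEQ_le_const2[of _ ?b]) auto
  qed
  \<comment> \<open>Continuity from above: the uniform bound survives the passage to all
    clusters.\<close>
  have "(\<lambda>m. M.prob (?B m)) \<longlonglongrightarrow> M.prob (\<Inter>m. ?B m)"
  proof (rule M.finite_Lim_measure_decseq)
    show "range ?B \<subseteq> sets M"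
      using B by blast
    show "decseq ?B"
      by (rule decseq_SucI) auto
  qed
  then have "?b \<le> M.prob (\<Inter>m. ?B m)"
    using lower by (intro LIMSEQ_le_const) auto
  also have "\<dots> \<le> void_probability M (all_clusters C) r"
    unfolding void_probability_def
  proof (rule M.finite_measure_mono)
    show "(\<Inter>m. ?B m) \<subseteq> {\<omega> \<in> space M. num_points (all_clusters C \<omega>) (cball 0 r) = 0}"
    proof
      fix \<omega> assume "\<omega> \<in> (\<Inter>m. ?B m)"
      then have \<omega>: "\<omega> \<in> space M" and less: "K i \<omega> < N i \<omega>" for i
        by (auto dest: spec[of _ "Suc i"])
      have "r < norm y" if y: "y \<in> C i \<omega>" for i y
      proof -
        have "finite (C i \<omega>)"
          using pcp \<omega> by (simp add: poisson_cluster_process_def finite_point_process_def)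
        then have "norm (y - X i \<omega>) \<le> real (K i \<omega>)"
          unfolding K_def using y by (intro norm_le_reach) (auto simp: centered_cluster_def)
        \<comment> \<open>An integer strictly below a ceiling is strictly below the number itself.
          Strictness also makes \<open>N i\<close> positive, so \<open>nat\<close> has truncated
          nothing.\<close>
        also have "\<dots> < norm (X i \<omega>) - r"
          using less[of i] unfolding N_def by linarith
        finally show ?thesis
          using norm_triangle_ineq2[of "X i \<omega>" y] by (simp add: norm_minus_commute)
      qed
      then show "\<omega> \<in> {\<omega> \<in> space M. num_points (all_clusters C \<omega>) (cball 0 r) = 0}"
        using \<omega> by (fastforce simp: num_points_eq_0_iff all_clusters_def)
    qed
  qed (rule void_event_measurable, simp)
  finally show ?thesis .
qed

section \<open>Asymptotics of the moment\<close>

lemma expectation_reach_power_asymp: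
  assumes L: "integrable M0 (\<lambda>\<omega>. cluster_radius (C0 \<omega>) ^ d)"
  shows "((\<lambda>r. (\<integral>\<omega>. (r + real (reach (C0 \<omega>))) ^ d \<partial>M0) / r ^ d) \<longlongrightarrow> 1) at_top"
proof -
  have "((\<lambda>r. \<integral>\<omega>. ((r + real (reach (C0 \<omega>))) / r) ^ d \<partial>M0) \<longlongrightarrow> (\<integral>\<omega>. 1 \<partial>M0)) at_top"
  proof (rule integral_dominated_convergence_at_top)
    show "integrable M0 (\<lambda>\<omega>. (1 + real (reach (C0 \<omega>))) ^ d)"
      using L by (rule integrable_reach_power) simp
    show "(\<lambda>\<omega>. ((r + real (reach (C0 \<omega>))) / r) ^ d) \<in> borel_measurable M0" for r
      using measurable_reach_C0 by (rule measurable_compose) simp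
    have "((\<lambda>r. ((r + k) / r) ^ d) \<longlongrightarrow> 1) at_top" for k :: real
    proof -
      have "((\<lambda>r. (1 + k / r) ^ d) \<longlongrightarrow> (1 + 0) ^ d) at_top"
        by (intro tendsto_intros tendsto_divide_0[OF tendsto_const filterlim_at_top_imp_at_infinity] filterlim_ident)
      moreover have "\<forall>\<^sub>F r in at_top. (1 + k / r) ^ d = ((r + k) / r) ^ d"
        using eventually_gt_at_top[of 0] by eventually_elim (simp add: add_divide_distrib)
      ultimately show ?thesis
        by (simp add: Lim_transform_eventually)
    qed
    then show "AE \<omega> in M0. ((\<lambda>r. ((r + real (reach (C0 \<omega>))) / r) ^ d) \<longlongrightarrow> 1) at_top"
      by simp
    \<comment> \<open>For \<open>r\<close> at least 1, \<open>(r + k) / r = 1 + k / r\<close> is at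
      most \<open>1 + k\<close>; the moment assumption at radius 1 makes this dominating function
      integrable.\<close>
    show "\<forall>\<^sub>F r in at_top. AE \<omega> in M0. norm (((r + real (reach (C0 \<omega>))) / r) ^ d) \<le> (1 + real (reach (C0 \<omega>))) ^ d"
      using eventually_ge_at_top[of 1]
    proof eventually_elim
      fix r :: real assume r: "1 \<le> r"
      have "(r + real k) / r \<le> 1 + real k" for k
        using r mult_right_mono[OF r, of "real k"] by (simp add: field_simps)
      then show "AE \<omega> in M0. norm (((r + real (reach (C0 \<omega>))) / r) ^ d) \<le> (1 + real (reach (C0 \<omega>))) ^ d"
        using r by (auto simp: norm_power intro!: power_mono)
    qed
  qed simp
  then show ?thesis
    by (simp add: power_divide M0.prob_space)
qed

end

section \<open>Squeezing the normalized logarithm\<close>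

theorem proposition5p3:
  fixes M :: "'w measure" and M0 :: "'c measure" and \<nu> :: real
    and I :: "'w \<Rightarrow> 'a::euclidean_space set" and X :: "nat \<Rightarrow> 'w \<Rightarrow> 'a"
    and C :: "nat \<Rightarrow> 'w \<Rightarrow> 'a set" and C0 :: "'c \<Rightarrow> 'a set"
  assumes "\<nu> > 0"
    and "poisson_cluster_process M \<nu> I X C M0 C0"
    and "integrable M0 (\<lambda>\<omega>. real (card (C0 \<omega>)))"
    and "integrable M0 (\<lambda>\<omega>. cluster_radius (C0 \<omega>) ^ DIM('a))"
  shows "((\<lambda>r. 1 / (r ^ DIM('a) * unit_ball_vol (real DIM('a))) *
             ln (void_probability M (all_clusters C) r)) \<longlongrightarrow> - \<nu>) at_top"
proof (rule tendsto_sandwich)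
  let ?m = "\<lambda>r. \<integral>\<omega>. (r + real (reach (C0 \<omega>))) ^ DIM('a) \<partial>M0"
  let ?v = "void_probability M (all_clusters C)"
  let ?\<kappa> = "unit_ball_vol (real DIM('a))"
  have \<kappa>: "?\<kappa> > 0" by simp
  \<comment> \<open>Both exponential bounds are passed through the logarithm and divided by the
    volume \<open>r ^ DIM('a) * ?\<kappa>\<close>.\<close>
  have bounds: "- \<nu> * (?m r / r ^ DIM('a)) \<le> 1 / (r ^ DIM('a) * ?\<kappa>) * ln (?v r) \<and>
      1 / (r ^ DIM('a) * ?\<kappa>) * ln (?v r) \<le> - \<nu>" if "r > 0" for r
  proof -
    have ge: "exp (- (\<nu> * (?\<kappa> * ?m r))) \<le> ?v r"
      using assms that by (intro void_probability_ge integrable_reach_power) auto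
    have le: "?v r \<le> exp (- (\<nu> * (?\<kappa> * r ^ DIM('a))))"
      using assms(2) that by (intro void_probability_le) auto
    \<comment> \<open>The logarithmic inequalities require a positive void probability, which the
      lower bound provides.\<close>
    have "0 < ?v r"
      using ge exp_gt_zero by (rule less_le_trans[rotated])
    then have "- (\<nu> * (?\<kappa> * ?m r)) \<le> ln (?v r)" "ln (?v r) \<le> - (\<nu> * (?\<kappa> * r ^ DIM('a)))"
      using ge le by (simp_all add: ln_ge_iff) (metis ln_exp ln_mono)
    then show ?thesis
      using \<kappa> that by (simp add: divide_simps mult_ac)
  qed
  show "\<forall>\<^sub>F r in at_top. - \<nu> * (?m r / r ^ DIM('a)) \<le> 1 / (r ^ DIM('a) * ?\<kappa>) * ln (?v r)"
    "\<forall>\<^sub>F r in at_top. 1 / (r ^ DIM('a) * ?\<kappa>) * ln (?v r) \<le> - \<nu>"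
    using bounds by (auto intro: eventually_mono[OF eventually_gt_at_top[of 0]])
  show "((\<lambda>r. - \<nu> * (?m r / r ^ DIM('a))) \<longlongrightarrow> - \<nu>) at_top"
    using tendsto_mult[OF tendsto_const expectation_reach_power_asymp[OF assms(2,4)], of "- \<nu>"] by simp
qed simp

end
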